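(* Let $D_1$ and $D_2$ be oriented graphs such that $\mathrm{inv}(D_1) = \mathrm{inv}(D_2) \ge 1$. Then $\mathrm{inv}(D_1 \rightarrow D_2) > \mathrm{inv}(D_1)$.
   Context: An oriented graph is a simple directed graph with no loops and at most one of the edges $uv$, $vu$ for each pair of distinct vertices $u,v$. For an oriented graph $D$ and $X\subseteq V(D)$, inverting $X$ means reversing the orientation of every edge with both endpoints in $X$. Inverting a family $X_1,\dots,X_k$ means inverting each set in turn. The inversion number $\mathrm{inv}(D)$ is the minimum $k$ such that some family $X_1,\dots,X_k\subseteq V(D)$, when inverted, yields an acyclic oriented graph. For oriented graphs $D_1,D_2$, the dijoin $D_1\rightarrow D_2$ is the oriented graph formed from vertex-disjoint copies of $D_1$ and $D_2$ by adding all edges $uv$ with $u\in V(D_1)$ and $v\in V(D_2)$. *)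

theory Defs
  imports "Graph_Theory.Graph_Theory"
begin

locale oriented_graph = pair_digraph D for D :: "'a pair_pre_digraph" +
  assumes no_antiparallel: "(u, v) \<in> parcs D \<Longrightarrow> (v, u) \<notin> parcs D"

definition invert :: "'a set \<Rightarrow> 'a pair_pre_digraph \<Rightarrow> 'a pair_pre_digraph" where
  "invert X D = \<lparr> pverts = pverts D,
     parcs = {(u, v). (u, v) \<in> parcs D \<and> \<not> (u \<in> X \<and> v \<in> X)} \<union>
             {(v, u) | u v. (u, v) \<in> parcs D \<and> u \<in> X \<and> v \<in> X} \<rparr>"

definition invert_family :: "'a set list \<Rightarrow> 'a pair_pre_digraph \<Rightarrow> 'a pair_pre_digraph" where
  "invert_family Xs D = fold invert Xs D"

definition acyclic_digraph :: "'a pair_pre_digraph \<Rightarrow> bool" where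
  "acyclic_digraph D \<longleftrightarrow> (\<nexists>p. pre_digraph.cycle (with_proj D) p)"

definition inversion_number :: "'a pair_pre_digraph \<Rightarrow> nat" where
  "inversion_number D = (LEAST k. \<exists>Xs. length Xs = k \<and> (\<forall>X \<in> set Xs. X \<subseteq> pverts D) \<and>
     acyclic_digraph (invert_family Xs D))"

definition dijoin ::
  "'a pair_pre_digraph \<Rightarrow> 'b pair_pre_digraph \<Rightarrow> ('a + 'b) pair_pre_digraph" where
  "dijoin D1 D2 = \<lparr> pverts = Inl ` pverts D1 \<union> Inr ` pverts D2,
     parcs = {(Inl u, Inl v) | u v. (u, v) \<in> parcs D1} \<union>
             {(Inr u, Inr v) | u v. (u, v) \<in> parcs D2} \<union>
             {(Inl u, Inr v) | u v. u \<in> pverts D1 \<and> v \<in> pverts D2} \<rparr>"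

lemma oriented_graph_dijoin:
  assumes "oriented_graph D1" "oriented_graph D2"
  shows "oriented_graph (dijoin D1 D2)"
proof -
  interpret D1: oriented_graph D1 by fact
  interpret D2: oriented_graph D2 by fact
  have sub: "parcs (dijoin D1 D2) \<subseteq> pverts (dijoin D1 D2) \<times> pverts (dijoin D1 D2)"
    by (auto simp: dijoin_def dest: D1.in_arcsD1 D1.in_arcsD2 D2.in_arcsD1 D2.in_arcsD2)
  have fin: "finite (pverts (dijoin D1 D2))"
    by (simp add: dijoin_def D1.pair_finite_verts D2.pair_finite_verts)
  show ?thesis
  proof unfold_locales
    show "finite (parcs (dijoin D1 D2))"
      using sub fin by (meson finite_SigmaI finite_subset)
  next
    fix e assume e: "e \<in> parcs (dijoin D1 D2)"
    show "fst e \<in> pverts (dijoin D1 D2)" "snd e \<in> pverts (dijoin D1 D2)"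
      using e sub by auto
    show "fst e \<noteq> snd e"
      using e by (auto simp: dijoin_def dest: D1.pair_no_loops D2.pair_no_loops)
  next
    fix u v assume "(u, v) \<in> parcs (dijoin D1 D2)"
    then show "(v, u) \<notin> parcs (dijoin D1 D2)"
      by (auto simp: dijoin_def dest: D1.no_antiparallel D2.no_antiparallel)
  qed (rule fin)
qed

lemma oriented_graph_invert:
  assumes "oriented_graph D"
  shows "oriented_graph (invert X D)"
proof -
  interpret oriented_graph D by fact
  have sub: "parcs (invert X D) \<subseteq> pverts D \<times> pverts D"
    by (auto simp: invert_def dest: in_arcsD1 in_arcsD2)
  have ve: "pverts (invert X D) = pverts D"
    by (simp add: invert_def)
  show ?thesis
  proof unfold_locales
    show "finite (parcs (invert X D))"
      using sub pair_finite_verts by (meson finite_SigmaI finite_subset)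
  qed (use sub pair_finite_verts in \<open>auto simp: ve\<close>,
       auto simp: invert_def dest: no_antiparallel pair_no_loops)
qed

lemma (in pair_wf_digraph) acyclic_digraph_iff: "acyclic_digraph G \<longleftrightarrow> acyclic (parcs G)"
proof
  assume a: "acyclic_digraph G"
  show "acyclic (parcs G)"
  proof (rule acyclicI, safe)
    fix x assume "(x, x) \<in> (parcs G)\<^sup>+"
    then obtain p where "awalk x p x" "p \<noteq> []"
      using reachable1_awalk by auto
    then have "closed_w p" by (auto simp: closed_w_def)
    then obtain c where "cycle c" using closed_w_imp_cycle by auto
    then show False using a by (auto simp: acyclic_digraph_def)
  qed
next
  assume "acyclic (parcs G)"
  then show "acyclic_digraph G"
    unfolding acyclic_digraph_def cycle_def acyclic_def using reachable1_awalk by blast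
qed

text \<open>The set of lengths in \<^const>\<open>inversion_number\<close> is never empty.\<close>

lemma decycling_family_exists:
  assumes "oriented_graph D"
  shows "\<exists>Xs. (\<forall>X \<in> set Xs. X \<subseteq> pverts D) \<and> acyclic_digraph (invert_family Xs D)"
proof -
  obtain f :: "'a \<Rightarrow> nat" where inj: "inj_on f (pverts D)"
    using assms finite_imp_inj_to_nat_seg[of "pverts D"]
    by (auto simp: oriented_graph_def pair_digraph_def pair_fin_digraph_def
        pair_fin_digraph_axioms_def)
  then show ?thesis using assms
  proof (induction "card {(u, v) \<in> parcs D. f v \<le> f u}" arbitrary: D rule: less_induct)
    case less
    interpret oriented_graph D by (rule less.prems)
    let ?B = "\<lambda>D. {(u, v) \<in> parcs D. f v \<le> f u}"
    show ?case
    proof (cases "?B D = {}")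
      case True
      then have "parcs D \<subseteq> measure f" by fastforce
      then have "acyclic (parcs D)" by (meson acyclic_subset wf_acyclic wf_measure)
      then have "acyclic_digraph D" using acyclic_digraph_iff by simp
      then show ?thesis by (intro exI[of _ "[]"]) (simp add: invert_family_def)
    next
      case False
      then obtain u v where uv: "(u, v) \<in> parcs D" "f v \<le> f u" by blast
      have ne: "f v < f u"
        using uv less.prems(1) in_arcsD1 in_arcsD2 pair_no_loops[of "(u, v)"]
        by (metis fst_conv snd_conv inj_onD le_neq_implies_less)
      let ?D = "invert {u, v} D"
      have "?B ?D \<subset> ?B D"
        using uv ne no_antiparallel pair_no_loops by (fastforce simp: invert_def)
      moreover have "finite (?B D)"
        using pair_finite_arcs by (rule finite_subset[rotated]) auto
      ultimately have "card (?B ?D) < card (?B D)" by (rule psubset_card_mono[rotated])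
      moreover have ve: "pverts ?D = pverts D" by (simp add: invert_def)
      ultimately obtain Xs where Xs: "\<forall>X \<in> set Xs. X \<subseteq> pverts D"
        "acyclic_digraph (invert_family Xs ?D)"
        using less.hyps[of ?D] less.prems oriented_graph_invert by auto
      then show ?thesis
        using uv(1) by (intro exI[of _ "{u, v} # Xs"])
          (auto simp: invert_family_def dest: in_arcsD1 in_arcsD2)
    qed
  qed
qed

end

theory Submission
  imports Defs "HOL-Library.Z2"
begin

text \<open>
  A family of \<open>k\<close> inverted sets assigns to each vertex a vector in \<open>F\<^sub>2\<^sup>k\<close>, and an edge is
  reversed iff the product of its end vectors is \<open>1\<close>. Suppose that \<open>k = inv(D\<^sub>1) = inv(D\<^sub>2)\<close> sets
  decycle the dijoin, with vectors \<open>x\<^sub>u\<close> on \<open>D\<^sub>1\<close> and \<open>y\<^sub>w\<close> on \<open>D\<^sub>2\<close>. If some \<open>z \<noteq> 0\<close> is orthogonal to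
  all \<open>x\<^sub>u\<close>, then a linear map preserving all products of the \<open>x\<^sub>u\<close> kills a coordinate, contradicting
  \<open>inv(D\<^sub>1) = k\<close>, unless \<open>z\<close> is the all-ones vector and \<open>k\<close> is odd; likewise for \<open>D\<^sub>2\<close>. It follows
  that the vectors of one of the two graphs, say \<open>D\<^sub>2\<close>, are determined by their products with the
  vectors of the other one. As the inverted dijoin is acyclic, the sets \<open>N(w) = {u. x\<^sub>u y\<^sub>w = 1}\<close> form
  a chain. Hence the distinct nonzero \<open>y\<^sub>w\<close> are linearly independent, so there are at most \<open>k\<close> of
  them, and each of their classes is an interval of the final order of \<open>D\<^sub>2\<close>. Reversing a whole class
  is then harmless, so only the products of distinct vectors matter; these can be realised with one
  coordinate fewer than there are vectors, so \<open>inv(D\<^sub>2) \<le> k - 1\<close>.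
\<close>

declare add_bit_eq_xor [simp del] mult_bit_eq_and [simp del]

lemma bit_add_self [simp]: "a + a = (0::bit)"
  by (cases a) simp_all

lemma bit_add_eq_0_iff: "a + b = 0 \<longleftrightarrow> a = (b::bit)"
  by (cases a; cases b) simp_all

lemma bit_eq_iff_eq_1: "a = b \<longleftrightarrow> (a = 1 \<longleftrightarrow> b = (1::bit))"
  by (cases a; cases b) simp_all


section \<open>Vectors over the two-element field\<close>

definition dot :: "nat \<Rightarrow> (nat \<Rightarrow> bit) \<Rightarrow> (nat \<Rightarrow> bit) \<Rightarrow> bit" where
  "dot k x y = (\<Sum>i<k. x i * y i)"

lemma dot_commute: "dot k x y = dot k y x"
  by (simp add: dot_def mult.commute)

lemma dot_zero [simp]: "dot k (\<lambda>_. 0) x = 0" "dot k x (\<lambda>_. 0) = 0"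
  by (simp_all add: dot_def)

lemma dot_add_left: "dot k (\<lambda>i. x i + y i) z = dot k x z + dot k y z"
  by (simp add: dot_def distrib_right sum.distrib)

lemma dot_add_right: "dot k z (\<lambda>i. x i + y i) = dot k z x + dot k z y"
  by (simp add: dot_def distrib_left sum.distrib)

lemma dot_scale_left: "dot k (\<lambda>i. c * x i) z = c * dot k x z"
  by (simp add: dot_def sum_distrib_left mult.assoc)

lemma dot_scale_right: "dot k z (\<lambda>i. c * x i) = c * dot k z x"
  by (simp add: dot_def sum_distrib_left mult.left_commute)

lemma dot_sum_left: "dot k (\<lambda>i. \<Sum>c\<in>T. f c i) z = (\<Sum>c\<in>T. dot k (f c) z)"
  unfolding dot_def sum_distrib_right by (rule sum.swap)

lemma dot_Suc: "dot (Suc k) x y = dot k x y + x k * y k"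
  by (simp add: dot_def)

lemma dot_cong:
  assumes "\<And>i. i < k \<Longrightarrow> x i = x' i" "\<And>i. i < k \<Longrightarrow> y i = y' i"
  shows "dot k x y = dot k x' y'"
  using assms by (simp add: dot_def)

lemma dot_extend:
  assumes "k \<le> m" "\<And>i. k \<le> i \<Longrightarrow> x i = 0"
  shows "dot m x y = dot k x y"
  unfolding dot_def using assms by (intro sum.mono_neutral_right) auto

lemma dot_unit_left:
  assumes "j < k"
  shows "dot k (\<lambda>i. of_bool (i = j)) x = x j"
proof -
  have "dot k (\<lambda>i. of_bool (i = j)) x = (\<Sum>i<k. if i = j then x i else 0)"
    unfolding dot_def by (rule sum.cong) auto
  then show ?thesis using assms by simp
qed

text \<open>The \<open>j\<close>-th term vanishes, and the last coordinate \<open>m\<close> moves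
  into the slot \<open>j\<close>, so the remaining indices again form an initial segment.\<close>

lemma dot_drop_coordinate:
  assumes "j < Suc m" "x j = 0"
  shows "dot m (\<lambda>i. x (if i = j then m else i)) (\<lambda>i. y (if i = j then m else i)) = dot (Suc m) x y"
proof -
  have "dot (Suc m) x y = (\<Sum>i\<in>{..<Suc m} - {j}. x i * y i)"
    unfolding dot_def using assms by (intro sum.mono_neutral_right) auto
  also have "\<dots> = (\<Sum>i<m. x (if i = j then m else i) * y (if i = j then m else i))"
    by (rule sum.reindex_bij_witness
        [where i = "\<lambda>i. if i = j then m else i" and j = "\<lambda>i. if i = m then j else i"])
      (use assms in \<open>auto split: if_splits\<close>)
  finally show ?thesis by (simp add: dot_def)
qed

text \<open>The map \<open>x \<mapsto> x + x\<^sub>j z\<close> is an isometry in both cases; in the second one it is a transvection.\<close>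

lemma dot_isometry:
  assumes "dot k z z = 0"
    and "dot k z x = 0 \<and> dot k z y = 0 \<or> dot k z x = x j \<and> dot k z y = y j"
  shows "dot k (\<lambda>i. x i + x j * z i) (\<lambda>i. y i + y j * z i) = dot k x y"
proof -
  have "dot k (\<lambda>i. x i + x j * z i) (\<lambda>i. y i + y j * z i) =
      dot k x y + (y j * dot k z x + x j * dot k z y) + x j * (y j * dot k z z)"
    by (simp add: dot_add_left dot_add_right dot_scale_left dot_scale_right dot_commute[of k x z]
        algebra_simps)
  \<comment> \<open>In the second case both summands are \<open>x j * y j\<close> and
    cancel.\<close>
  also have "y j * dot k z x + x j * dot k z y = 0"
    using assms(2) by (auto simp: mult.commute)
  finally show ?thesis using assms(1) by simp
qed

text \<open>Gaussian elimination with a free diagonal: each vector but the last needs only one new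
  coordinate.\<close>

lemma gram_off_diagonal:
  fixes g :: "'c \<Rightarrow> 'c \<Rightarrow> bit"
  assumes "finite C" "\<And>c d. g c d = g d c"
  shows "\<exists>f. \<forall>c\<in>C. \<forall>d\<in>C. c \<noteq> d \<longrightarrow> dot (card C - 1) (f c) (f d) = g c d"
  using assms
proof (induction C arbitrary: g rule: finite_induct)
  case empty
  then show ?case by simp
next
  case (insert c C)
  show ?case
  proof (cases "C = {}")
    \<comment> \<open>A single vector has no off-diagonal product, so no coordinate is spent on it;
      the \<open>- 1\<close> comes from here.\<close>
    case True
    then show ?thesis by simp
  next
    case False
    define m where "m = card C - 1"
    have card: "card (insert c C) - 1 = Suc m"
      using insert.hyps False by (simp add: m_def card_gt_0_iff)
    \<comment> \<open>Coordinate \<open>m\<close> will be the only nonzero one of \<open>c\<close>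
      and will hold \<open>g c a\<close> for every other \<open>a\<close>. Its contribution
      \<open>g c a * g c b\<close> is removed beforehand, by adding it.\<close>
    obtain f where f: "\<And>a b. a \<in> C \<Longrightarrow> b \<in> C \<Longrightarrow> a \<noteq> b \<Longrightarrow>
        dot m (f a) (f b) = g a b + g c a * g c b"
      using insert.IH[of "\<lambda>a b. g a b + g c a * g c b"] insert.prems
      unfolding m_def by (metis mult.commute)
    define f' where "f' = (\<lambda>a i. if a = c then of_bool (i = m) else if i = m then g c a else f a i)"
    have low: "dot m (f' a) (f' b) = (if a = c \<or> b = c then 0 else dot m (f a) (f b))" for a b
    proof -
      have "dot m (f' a) (f' b) = dot m (if a = c then \<lambda>_. 0 else f a) (if b = c then \<lambda>_. 0 else f b)"
        by (rule dot_cong) (auto simp: f'_def)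
      then show ?thesis by auto
    qed
    have "dot (Suc m) (f' a) (f' b) = g a b"
      if "a \<in> insert c C" "b \<in> insert c C" "a \<noteq> b" for a b
    proof (cases "a = c \<or> b = c")
      case True
      then show ?thesis using that insert.prems by (auto simp: dot_Suc low) (auto simp: f'_def)
    next
      case False
      then show ?thesis
        using that f[of a b] by (auto simp: dot_Suc low) (auto simp: f'_def add.assoc)
    qed
    then show ?thesis unfolding card by blast
  qed
qed

text \<open>Among finitely many sets forming a chain, the largest one has a point outside all others;
  hence vectors with nested supports are linearly independent.\<close>

lemma chain_sum_eq_1:
  assumes "finite T" "T \<noteq> {}"
    and fin: "\<And>c. c \<in> T \<Longrightarrow> finite (N c)" and ne: "\<And>c. c \<in> T \<Longrightarrow> N c \<noteq> {}"
    and inj: "inj_on N T"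
    and chain: "\<And>c d. c \<in> T \<Longrightarrow> d \<in> T \<Longrightarrow> N c \<subseteq> N d \<or> N d \<subseteq> N c"
  obtains u c where "c \<in> T" "u \<in> N c" "(\<Sum>c\<in>T. of_bool (u \<in> N c) :: bit) = 1"
proof -
  have "\<exists>c\<in>T. \<forall>d\<in>T. N c \<subseteq> N d \<longrightarrow> N c = N d"
    using finite_has_maximal[of "N ` T"] assms(1,2) by auto
  then obtain c where c: "c \<in> T" and "\<And>d. d \<in> T \<Longrightarrow> N c \<subseteq> N d \<Longrightarrow> N c = N d" by blast
  then have max: "\<not> N c \<subseteq> N d" if "d \<in> T - {c}" for d
    using that inj by (metis DiffD1 DiffD2 inj_onD singletonI)
  \<comment> \<open>A finite set covered by a nonempty chain lies in one member of it, which
    \<open>max\<close> excludes.\<close>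
  have "\<not> N c \<subseteq> \<Union> (N ` (T - {c}))"
  proof
    assume sub: "N c \<subseteq> \<Union> (N ` (T - {c}))"
    moreover have "subset.chain UNIV (N ` (T - {c}))"
      using chain by (auto simp: subset_chain_def)
    moreover have "N ` (T - {c}) \<noteq> {}" using sub ne[OF c] by auto
    ultimately obtain B where "B \<in> N ` (T - {c})" "N c \<subseteq> B"
      using finite_subset_Union_chain[OF fin[OF c]] by metis
    then show False using max by auto
  qed
  then obtain u where u: "u \<in> N c" "\<And>d. d \<in> T - {c} \<Longrightarrow> u \<notin> N d" by blast
  have "(\<Sum>c\<in>T. of_bool (u \<in> N c) :: bit) = (\<Sum>d\<in>{c}. of_bool (u \<in> N d))"
    using u c assms(1) by (intro sum.mono_neutral_right) auto
  then show thesis using that c u by simp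
qed

text \<open>By independence, distinct subsets of \<open>C\<close> have distinct sums among the 2^k
  vectors of length \<open>k\<close>.\<close>

lemma card_le_of_chain:
  assumes "finite C" "finite V"
    and N: "\<And>c. N c = {u \<in> V. dot k c (x u) = 1}"
    and ne: "\<And>c. c \<in> C \<Longrightarrow> N c \<noteq> {}" and inj: "inj_on N C"
    and chain: "\<And>c d. c \<in> C \<Longrightarrow> d \<in> C \<Longrightarrow> N c \<subseteq> N d \<or> N d \<subseteq> N c"
  shows "card C \<le> k"
proof -
  define S where "S = (\<lambda>T. {i. i < k \<and> (\<Sum>c\<in>T. c i) = (1::bit)})"
  have "inj_on S (Pow C)"
  proof (rule inj_onI, rule ccontr)
    fix T T' assume T: "T \<in> Pow C" "T' \<in> Pow C" and eq: "S T = S T'" and neq: "T \<noteq> T'"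
    \<comment> \<open>Equal sums over \<open>T\<close> and \<open>T'\<close> cancel to 0 over the
      symmetric difference, but pairing this sum with a suitable \<open>x u\<close> gives 1.\<close>
    define U where "U = (T - T') \<union> (T' - T)"
    have fin: "finite T" "finite T'" using T assms(1) by (auto intro: finite_subset)
    have sum: "(\<Sum>c\<in>U. c i) = 0" if "i < k" for i
    proof -
      have "(\<Sum>c\<in>T. c i) = (\<Sum>c\<in>T'. c i)"
        using eq that unfolding S_def set_eq_iff by (subst bit_eq_iff_eq_1) blast
      moreover have "(\<Sum>c\<in>T. c i) = (\<Sum>c\<in>T - T'. c i) + (\<Sum>c\<in>T \<inter> T'. c i)"
        using sum.Int_Diff[OF fin(1), of "\<lambda>c. c i" T'] by (simp add: add.commute)
      moreover have "(\<Sum>c\<in>T'. c i) = (\<Sum>c\<in>T' - T. c i) + (\<Sum>c\<in>T \<inter> T'. c i)"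
        using sum.Int_Diff[OF fin(2), of "\<lambda>c. c i" T] by (simp add: add.commute Int_commute)
      moreover have "(\<Sum>c\<in>U. c i) = (\<Sum>c\<in>T - T'. c i) + (\<Sum>c\<in>T' - T. c i)"
        unfolding U_def using fin by (intro sum.union_disjoint) auto
      ultimately show ?thesis by (simp add: bit_add_eq_0_iff)
    qed
    have U: "U \<subseteq> C" "U \<noteq> {}" "finite U" using T neq fin by (auto simp: U_def)
    have finN: "finite (N c)" for c using assms(2) by (simp add: N)
    have neU: "N c \<noteq> {}" if "c \<in> U" for c using ne U(1) that by blast
    have chainU: "N c \<subseteq> N d \<or> N d \<subseteq> N c" if "c \<in> U" "d \<in> U" for c d
      using chain U(1) that by blast
    obtain u c where uc: "c \<in> U" "u \<in> N c" "(\<Sum>c\<in>U. of_bool (u \<in> N c) :: bit) = 1"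
      using chain_sum_eq_1[OF U(3,2) finN neU inj_on_subset[OF inj U(1)] chainU] by metis
    have "dot k d (x u) = of_bool (u \<in> N d)" for d
      using uc(2) by (cases "dot k d (x u)") (auto simp: N)
    then have "dot k (\<lambda>i. \<Sum>c\<in>U. c i) (x u) = 1"
      unfolding dot_sum_left using uc(3) by presburger
    moreover have "dot k (\<lambda>i. \<Sum>c\<in>U. c i) (x u) = dot k (\<lambda>_. 0) (x u)"
      by (rule dot_cong) (use sum in auto)
    ultimately show False by simp
  qed
  moreover have "S ` Pow C \<subseteq> Pow {..<k}" by (auto simp: S_def)
  ultimately have "card (Pow C) \<le> card (Pow {..<k})"
    by (intro card_inj_on_le) auto
  then show ?thesis using assms(1) by (simp add: card_Pow)
qed


section \<open>Inversions as vector assignments\<close>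

text \<open>The \<open>i\<close>-th coordinate of \<open>x u\<close> says whether \<open>u\<close> lies in the \<open>i\<close>-th inverted set.\<close>

definition flip_arcs :: "nat \<Rightarrow> ('a \<Rightarrow> nat \<Rightarrow> bit) \<Rightarrow> ('a \<times> 'a) set \<Rightarrow> ('a \<times> 'a) set" where
  "flip_arcs k x R = {(u, v). (u, v) \<in> R \<and> dot k (x u) (x v) = 0} \<union>
     {(u, v). (v, u) \<in> R \<and> dot k (x u) (x v) = 1}"

lemma flip_arcs_cong:
  assumes "R \<subseteq> V \<times> V" "\<And>u v. u \<in> V \<Longrightarrow> v \<in> V \<Longrightarrow> dot k (x u) (x v) = dot m (y u) (y v)"
  shows "flip_arcs k x R = flip_arcs m y R"
  using assms unfolding flip_arcs_def by auto

lemma flip_arcs_converse: "flip_arcs k x (R\<inverse>) = (flip_arcs k x R)\<inverse>"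
  by (auto simp: flip_arcs_def dot_commute)

text \<open>An edge is reversed once for every set containing both ends, so only the parity of their
  number counts: the product of the end vectors.\<close>

lemma invert_family_props:
  assumes "oriented_graph D"
  shows "oriented_graph (invert_family Xs D) \<and>
    parcs (invert_family Xs D) = flip_arcs (length Xs) (\<lambda>u i. of_bool (u \<in> Xs ! i)) (parcs D)"
proof (induction Xs rule: rev_induct)
  case Nil
  then show ?case using assms by (simp add: invert_family_def flip_arcs_def dot_def)
next
  case (snoc X Xs)
  let ?E = "invert_family Xs D"
  have step: "invert_family (Xs @ [X]) D = invert X ?E"
    by (simp add: invert_family_def)
  have dot: "dot (Suc (length Xs)) (\<lambda>i. of_bool (u \<in> (Xs @ [X]) ! i)) (\<lambda>i. of_bool (v \<in> (Xs @ [X]) ! i))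
     = dot (length Xs) (\<lambda>i. of_bool (u \<in> Xs ! i)) (\<lambda>i. of_bool (v \<in> Xs ! i)) + of_bool (u \<in> X \<and> v \<in> X)"
    for u v
  proof -
    have "dot (length Xs) (\<lambda>i. of_bool (u \<in> (Xs @ [X]) ! i)) (\<lambda>i. of_bool (v \<in> (Xs @ [X]) ! i))
      = dot (length Xs) (\<lambda>i. of_bool (u \<in> Xs ! i)) (\<lambda>i. of_bool (v \<in> Xs ! i))"
      by (rule dot_cong) (auto simp: nth_append)
    then show ?thesis by (simp add: dot_Suc)
  qed
  have "parcs (invert X ?E) = flip_arcs (Suc (length Xs)) (\<lambda>u i. of_bool (u \<in> (Xs @ [X]) ! i)) (parcs D)"
    unfolding invert_def pair_pre_digraph.simps conjunct2[OF snoc] unfolding flip_arcs_def dot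
    by (auto simp: dot_commute of_bool_def split: if_splits)
  then show ?case
    using snoc oriented_graph_invert step by (metis length_append_singleton)
qed

lemma acyclic_invert_family_iff:
  assumes "oriented_graph D"
  shows "acyclic_digraph (invert_family Xs D) \<longleftrightarrow>
    acyclic (flip_arcs (length Xs) (\<lambda>u i. of_bool (u \<in> Xs ! i)) (parcs D))"
proof -
  interpret oriented_graph "invert_family Xs D"
    using invert_family_props[OF assms] by blast
  show ?thesis using acyclic_digraph_iff invert_family_props[OF assms] by simp
qed

lemma inversion_number_leI:
  assumes "oriented_graph D" "acyclic (flip_arcs k x (parcs D))"
  shows "inversion_number D \<le> k"
proof -
  interpret oriented_graph D by fact
  define Xs where "Xs = map (\<lambda>i. {u \<in> pverts D. x u i = 1}) [0..<k]"
  have "flip_arcs k x (parcs D) = flip_arcs k (\<lambda>u i. of_bool (u \<in> Xs ! i)) (parcs D)"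
  proof (rule flip_arcs_cong[where V = "pverts D"])
    show "parcs D \<subseteq> pverts D \<times> pverts D" using in_arcsD1 in_arcsD2 by auto
    fix u v assume "u \<in> pverts D" "v \<in> pverts D"
    then show "dot k (x u) (x v) = dot k (\<lambda>i. of_bool (u \<in> Xs ! i)) (\<lambda>i. of_bool (v \<in> Xs ! i))"
      by (intro dot_cong) (auto simp: Xs_def of_bool_def)
  qed
  then have "acyclic_digraph (invert_family Xs D)"
    using acyclic_invert_family_iff[OF assms(1), of Xs] assms(2) by (simp add: Xs_def)
  then show ?thesis
    unfolding inversion_number_def by (intro Least_le exI[of _ Xs]) (auto simp: Xs_def)
qed

text \<open>A family shorter than \<open>k\<close> is padded with zeros. As all vectors vanish from
  \<open>k\<close> on, agreeing in the first \<open>k\<close> coordinates means being equal as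
  functions.\<close>

lemma inversion_number_leE:
  assumes "oriented_graph D" "inversion_number D \<le> k"
  obtains x where "\<And>u i. k \<le> i \<Longrightarrow> x u i = 0" "acyclic (flip_arcs k x (parcs D))"
proof -
  let ?P = "\<lambda>k. \<exists>Xs. length Xs = k \<and> (\<forall>X \<in> set Xs. X \<subseteq> pverts D) \<and> acyclic_digraph (invert_family Xs D)"
  have "\<exists>k. ?P k" using decycling_family_exists[OF assms(1)] by blast
  then have "?P (inversion_number D)" unfolding inversion_number_def by (rule LeastI_ex)
  then obtain Xs where len: "length Xs = inversion_number D"
    and acyc: "acyclic (flip_arcs (length Xs) (\<lambda>u i. of_bool (u \<in> Xs ! i)) (parcs D))"
    using acyclic_invert_family_iff[OF assms(1)] by blast
  define x where "x = (\<lambda>u i. of_bool (i < length Xs \<and> u \<in> Xs ! i) :: bit)"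
  have "dot k (x u) (x v) = dot (length Xs) (\<lambda>i. of_bool (u \<in> Xs ! i)) (\<lambda>i. of_bool (v \<in> Xs ! i))" for u v
  proof -
    have "dot k (x u) (x v) = dot (length Xs) (x u) (x v)"
      by (rule dot_extend) (use assms(2) len in \<open>auto simp: x_def\<close>)
    also have "\<dots> = dot (length Xs) (\<lambda>i. of_bool (u \<in> Xs ! i)) (\<lambda>i. of_bool (v \<in> Xs ! i))"
      by (rule dot_cong) (auto simp: x_def)
    finally show ?thesis .
  qed
  then have "acyclic (flip_arcs k x (parcs D))"
    using acyc by (simp add: flip_arcs_def)
  then show thesis using that[of x] assms(2) len by (auto simp: x_def)
qed


section \<open>Saving one inversion\<close>

text \<open>If \<open>z' j = 1\<close>, adding \<open>x u j * z'\<close> to each \<open>x u\<close>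
  clears coordinate \<open>j\<close>, and a suitable \<open>z'\<close> keeps all products. Given
  \<open>supp\<close>, the condition \<open>other\<close> fails exactly for the all-ones vector with
  \<open>k\<close> odd.\<close>

lemma annihilator_saves_inversion:
  assumes R: "R \<subseteq> V \<times> V" and acyc: "acyclic (flip_arcs k x R)"
    and ann: "\<And>u. u \<in> V \<Longrightarrow> dot k z (x u) = 0"
    and supp: "\<And>i. k \<le> i \<Longrightarrow> z i = 0" and nz: "z \<noteq> (\<lambda>_. 0)"
    and other: "dot k z z = 0 \<or> (\<exists>i<k. z i = 0)"
  shows "\<exists>y. acyclic (flip_arcs (k - 1) y R)"
proof -
  obtain j where ne: "j < k" "z j = 1"
    using nz supp by (metis bit_not_zero_iff not_le)
  obtain m where k: "k = Suc m" using ne(1) by (cases k) auto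
  have "\<exists>j z'. j < k \<and> z' j = 1 \<and> dot k z' z' = 0 \<and>
    ((\<forall>u\<in>V. dot k z' (x u) = 0) \<or> (\<forall>u\<in>V. dot k z' (x u) = x u j))"
  proof (cases "dot k z z = 0")
    case True
    then show ?thesis using ne ann by blast
  next
    case False
    then obtain i where i: "i < k" "z i = 0" using other by blast
    \<comment> \<open>Adding the unit vector at a zero of \<open>z\<close> turns its square from 1
      into 0; this is the transvection case of \<open>dot_isometry\<close>.\<close>
    define z' where "z' = (\<lambda>l. z l + of_bool (l = i))"
    have zx: "dot k z' y = dot k z y + y i" for y
      using i by (simp add: z'_def dot_add_left dot_unit_left)
    have "dot k z' z' = 0"
      using False i zx[of z] zx[of z'] by (simp add: dot_commute[of k z z']) (simp add: z'_def)
    moreover have "z' i = 1" using i by (simp add: z'_def)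
    moreover have "\<forall>u\<in>V. dot k z' (x u) = x u i" using zx ann by simp
    ultimately show ?thesis using i by blast
  qed
  then obtain j z' where z': "j < k" "z' j = 1" "dot k z' z' = 0"
    "(\<forall>u\<in>V. dot k z' (x u) = 0) \<or> (\<forall>u\<in>V. dot k z' (x u) = x u j)" by blast
  define y where "y = (\<lambda>u i. x u i + x u j * z' i)"
  define y' where "y' = (\<lambda>u i. y u (if i = j then m else i))"
  have "flip_arcs k x R = flip_arcs m y' R"
  proof (rule flip_arcs_cong[OF R])
    fix u v assume uv: "u \<in> V" "v \<in> V"
    have "dot m (y' u) (y' v) = dot k (y u) (y v)"
      unfolding y'_def k by (rule dot_drop_coordinate) (use z' k in \<open>simp_all add: y_def\<close>)
    also have "\<dots> = dot k (x u) (x v)"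
      unfolding y_def by (rule dot_isometry) (use z' uv in auto)
    finally show "dot k (x u) (x v) = dot m (y' u) (y' v)" by simp
  qed
  then show ?thesis using acyc k by auto
qed

text \<open>As \<open>N\<close> decreases along the inverted arcs, ordering first by
  \<open>N\<close> reduces acyclicity to the classes of equal vectors. Only products of distinct
  vectors need to be preserved.\<close>

lemma chain_saves_inversion:
  assumes R: "R \<subseteq> W \<times> W" and fin: "finite W" "finite V"
    and acyc: "acyclic (flip_arcs k y R)"
    and N: "\<And>c. N c = {u \<in> V. dot k c (x u) = 1}"
    and chain: "\<And>w w'. w \<in> W \<Longrightarrow> w' \<in> W \<Longrightarrow> N (y w) \<subseteq> N (y w') \<or> N (y w') \<subseteq> N (y w)"
    and mono: "\<And>w w'. (w, w') \<in> flip_arcs k y R \<Longrightarrow> N (y w') \<subseteq> N (y w)"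
    and inj: "inj_on N (y ` W)"
    and zero: "\<And>w. w \<in> W \<Longrightarrow> N (y w) = {} \<Longrightarrow> y w = (\<lambda>_. 0)"
  shows "\<exists>y'. acyclic (flip_arcs (k - 1) y' R)"
proof -
  define C where "C = y ` W - {\<lambda>_. 0}"
  have finC: "finite C" using fin by (simp add: C_def)
  have "card C \<le> k"
  proof (rule card_le_of_chain[OF finC fin(2) N])
    show "inj_on N C" using inj by (rule inj_on_subset) (auto simp: C_def)
    show "N c \<subseteq> N d \<or> N d \<subseteq> N c" if "c \<in> C" "d \<in> C" for c d
      using that chain unfolding C_def by blast
  qed (use zero in \<open>auto simp: C_def\<close>)
  obtain f where f: "\<And>c d. c \<in> C \<Longrightarrow> d \<in> C \<Longrightarrow> c \<noteq> d \<Longrightarrow> dot (card C - 1) (f c) (f d) = dot k c d"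
    using gram_off_diagonal[OF finC, of "dot k"] dot_commute by blast
  \<comment> \<open>Zero padding carries the products of \<open>f\<close> over to
    \<open>k - 1\<close> coordinates; the zero vector, outside \<open>C\<close>, stays zero.\<close>
  define y' where "y' = (\<lambda>w i. if y w \<in> C \<and> i < card C - 1 then f (y w) i else 0)"
  have dot': "dot (k - 1) (y' w) (y' w') = dot k (y w) (y w')"
    if "w \<in> W" "w' \<in> W" "y w \<noteq> y w'" for w w'
  proof (cases "y w \<in> C \<and> y w' \<in> C")
    case True
    have "dot (k - 1) (y' w) (y' w') = dot (card C - 1) (y' w) (y' w')"
      by (rule dot_extend) (use \<open>card C \<le> k\<close> in \<open>auto simp: y'_def\<close>)
    also have "\<dots> = dot (card C - 1) (f (y w)) (f (y w'))"
      by (rule dot_cong) (use True in \<open>auto simp: y'_def\<close>)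
    finally show ?thesis using f True that by simp
  next
    case False
    then have "y w = (\<lambda>_. 0) \<and> y' w = (\<lambda>_. 0) \<or> y w' = (\<lambda>_. 0) \<and> y' w' = (\<lambda>_. 0)"
      using that by (auto simp: C_def y'_def)
    then show ?thesis by auto
  qed
  have same: "y' w = y' w'" if "y w = y w'" for w w' unfolding y'_def that ..
  define F where "F = flip_arcs k y R"
  define G where "G = flip_arcs (k - 1) y' R"
  \<comment> \<open>On a class of vertices with equal vectors, the new inversions either agree everywhere with
    the old ones or are opposite everywhere.\<close>
  define s where "s = (\<lambda>w. dot k (y w) (y w) = dot (k - 1) (y' w) (y' w))"
  \<comment> \<open>A strict order containing \<open>G\<close>: first by shrinking \<open>N\<close>,
    then inside a class by the old reachability or its converse.\<close>
  define Q where "Q = (\<lambda>w w'. N (y w') \<subset> N (y w) \<or>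
    y w = y w' \<and> (if s w then (w, w') \<in> F\<^sup>+ else (w', w) \<in> F\<^sup>+))"
  have edge: "Q w w'" if "(w, w') \<in> G" for w w'
  proof -
    have W: "w \<in> W" "w' \<in> W" using that R by (auto simp: G_def flip_arcs_def)
    show ?thesis
    proof (cases "y w = y w'")
      case True
      then have "if s w then (w, w') \<in> F else (w', w) \<in> F"
        using that same[OF True] unfolding F_def G_def flip_arcs_def s_def
        by (cases "dot k (y w) (y w)"; cases "dot (k - 1) (y' w) (y' w)") auto
      then show ?thesis using True unfolding Q_def by (auto split: if_splits)
    next
      case False
      then have "(w, w') \<in> F" using that dot'[OF W] by (auto simp: F_def G_def flip_arcs_def)
      then have "N (y w') \<subseteq> N (y w)" using mono by (simp add: F_def)
      moreover have "N (y w') \<noteq> N (y w)" using inj False W by (auto dest: inj_onD)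
      ultimately show ?thesis by (auto simp: Q_def)
    qed
  qed
  have trans: "Q a c" if "Q a b" "Q b c" for a b c
  proof (cases "y a = y b \<and> y b = y c")
    case True
    then have "s a = s b" using same by (metis s_def)
    then show ?thesis using that True unfolding Q_def by (auto split: if_splits intro: trancl_trans)
  next
    case False
    then show ?thesis using that unfolding Q_def by auto
  qed
  have "Q a b" if "(a, b) \<in> G\<^sup>+" for a b
    using that by induction (use edge trans in blast)+
  moreover have "\<not> Q a a" for a
    using acyc unfolding Q_def F_def acyclic_def by auto
  ultimately have "acyclic G" unfolding acyclic_def by blast
  then show ?thesis unfolding G_def by blast
qed

section \<open>Acyclicity across the dijoin\<close>

theorem theorem1p2:
  fixes D1 :: "'a pair_pre_digraph" and D2 :: "'b pair_pre_digraph"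
  assumes "oriented_graph D1" and "oriented_graph D2"
    and "inversion_number D1 = inversion_number D2"
    and "inversion_number D1 \<ge> 1"
  shows "inversion_number (dijoin D1 D2) > inversion_number D1"
proof (rule ccontr)
  interpret D1: oriented_graph D1 by fact
  interpret D2: oriented_graph D2 by fact
  define k where "k = inversion_number D1"
  define V where "V = pverts D1"
  define W where "W = pverts D2"
  assume "\<not> inversion_number (dijoin D1 D2) > inversion_number D1"
  then have "inversion_number (dijoin D1 D2) \<le> k" by (simp add: k_def)
  then obtain r where supp: "\<And>u i. k \<le> i \<Longrightarrow> r u i = 0"
    and acyc: "acyclic (flip_arcs k r (parcs (dijoin D1 D2)))"
    using inversion_number_leE[OF oriented_graph_dijoin[OF assms(1,2)]] by blast
  define F where "F = flip_arcs k r (parcs (dijoin D1 D2))"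
  define x where "x = (\<lambda>u. r (Inl u))"
  define y where "y = (\<lambda>w. r (Inr w))"
  have R1: "parcs D1 \<subseteq> V \<times> V" using D1.in_arcsD1 D1.in_arcsD2 by (auto simp: V_def)
  have R2: "parcs D2 \<subseteq> W \<times> W" using D2.in_arcsD1 D2.in_arcsD2 by (auto simp: W_def)
  have fin: "finite V" "finite W" by (simp_all add: V_def W_def)
  \<comment> \<open>Since \<open>k\<close> is at least 1, \<open>k - 1\<close> is strictly
    smaller.\<close>
  have no1: "\<not> acyclic (flip_arcs (k - 1) x' (parcs D1))" for x'
    using inversion_number_leI[OF assms(1), of "k - 1" x'] assms(4) by (auto simp: k_def)
  have no2: "\<not> acyclic (flip_arcs (k - 1) y' (parcs D2))" for y'
    using inversion_number_leI[OF assms(2), of "k - 1" y'] assms(3,4) by (auto simp: k_def)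
  have F1: "(Inl u, Inl v) \<in> F" if "(u, v) \<in> flip_arcs k x (parcs D1)" for u v
    using that by (auto simp: F_def flip_arcs_def dijoin_def x_def)
  have F2: "(Inr u, Inr v) \<in> F" if "(u, v) \<in> flip_arcs k y (parcs D2)" for u v
    using that by (auto simp: F_def flip_arcs_def dijoin_def y_def)
  have F12: "(Inl u, Inr w) \<in> F" if "u \<in> V" "w \<in> W" "dot k (x u) (y w) = 0" for u w
    using that by (auto simp: F_def flip_arcs_def dijoin_def x_def y_def V_def W_def)
  have F21: "(Inr w, Inl u) \<in> F" if "u \<in> V" "w \<in> W" "dot k (x u) (y w) = 1" for u w
    using that by (auto simp: F_def flip_arcs_def dijoin_def x_def y_def V_def W_def dot_commute)
  have no3: False if "(a, b) \<in> F" "(b, c) \<in> F" "(c, a) \<in> F" for a b c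
    using that acyc unfolding F_def[symmetric] acyclic_def
    by (meson r_into_trancl' trancl_into_trancl)
  have no4: False if "(a, b) \<in> F" "(b, c) \<in> F" "(c, d) \<in> F" "(d, a) \<in> F" for a b c d
    using that acyc unfolding F_def[symmetric] acyclic_def
    by (meson r_into_trancl' trancl_into_trancl)
  have acyc1: "acyclic (flip_arcs k x (parcs D1))"
  proof -
    have "(Inl u, Inl v) \<in> F\<^sup>+" if "(u, v) \<in> (flip_arcs k x (parcs D1))\<^sup>+" for u v
      using that by induction (auto dest!: F1 intro: trancl_into_trancl)
    then show ?thesis using acyc unfolding F_def[symmetric] acyclic_def by blast
  qed
  have acyc2: "acyclic (flip_arcs k y (parcs D2))"
  proof -
    have "(Inr u, Inr v) \<in> F\<^sup>+" if "(u, v) \<in> (flip_arcs k y (parcs D2))\<^sup>+" for u v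
      using that by induction (auto dest!: F2 intro: trancl_into_trancl)
    then show ?thesis using acyc unfolding F_def[symmetric] acyclic_def by blast
  qed

  \<comment> \<open>After inversion, \<open>N (y w)\<close> holds the vertices of \<open>D1\<close>
    that \<open>w\<close> points to, and \<open>M (x u)\<close> the vertices of \<open>D2\<close>
    that point to \<open>u\<close>.\<close>
  define N where "N = (\<lambda>c. {u \<in> V. dot k c (x u) = 1})"
  define M where "M = (\<lambda>c. {w \<in> W. dot k c (y w) = 1})"
  have det2: False
    if "\<And>w. w \<in> W \<Longrightarrow> N (y w) = {} \<Longrightarrow> y w = (\<lambda>_. 0)" "inj_on N (y ` W)"
  proof -
    \<comment> \<open>Incomparable sets would give the cycle \<open>u\<close>, \<open>w'\<close>,
      \<open>u'\<close>, \<open>w\<close>.\<close>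
    have chain: "N (y w) \<subseteq> N (y w') \<or> N (y w') \<subseteq> N (y w)" if w: "w \<in> W" "w' \<in> W" for w w'
    proof (rule ccontr)
      assume "\<not> ?thesis"
      then obtain u u' where "u \<in> N (y w)" "u \<notin> N (y w')" "u' \<in> N (y w')" "u' \<notin> N (y w)" by blast
      then show False
        using no4[OF F12[of u w'] F21[of u' w'] F12[of u' w] F21[of u w]] w
        by (auto simp: N_def dot_commute)
    qed
    \<comment> \<open>Otherwise \<open>w\<close>, \<open>w'\<close>, \<open>u\<close> form a
      directed triangle.\<close>
    have mono: "N (y w') \<subseteq> N (y w)" if e: "(w, w') \<in> flip_arcs k y (parcs D2)" for w w'
    proof (rule ccontr)
      assume "\<not> ?thesis"
      then obtain u where "u \<in> N (y w')" "u \<notin> N (y w)" by blast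
      moreover have "w \<in> W" "w' \<in> W" using e R2 by (auto simp: flip_arcs_def)
      ultimately show False
        using no3[OF F2[OF e] F21[of u w'] F12[of u w]] by (auto simp: N_def dot_commute)
    qed
    show False
      using chain_saves_inversion[OF R2 fin(2,1) acyc2 _ chain mono that(2,1), where x = x] no2
      by (auto simp: N_def)
  qed
  have det1: False
    if "\<And>u. u \<in> V \<Longrightarrow> M (x u) = {} \<Longrightarrow> x u = (\<lambda>_. 0)" "inj_on M (x ` V)"
  proof -
    have chain: "M (x u) \<subseteq> M (x u') \<or> M (x u') \<subseteq> M (x u)" if u: "u \<in> V" "u' \<in> V" for u u'
    proof (rule ccontr)
      assume "\<not> ?thesis"
      then obtain w w' where "w \<in> M (x u)" "w \<notin> M (x u')" "w' \<in> M (x u')" "w' \<notin> M (x u)" by blast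
      then show False
        using no4[OF F12[of u w'] F21[of u' w'] F12[of u' w] F21[of u w]] u
        by (auto simp: M_def)
    qed
    \<comment> \<open>\<open>M\<close> grows along the inverted arcs of \<open>D1\<close>, so the
      saving lemma is applied to the converse arcs, for which acyclicity is the same.\<close>
    have mono: "M (x u') \<subseteq> M (x u)" if e: "(u, u') \<in> flip_arcs k x ((parcs D1)\<inverse>)" for u u'
    proof (rule ccontr)
      assume "\<not> ?thesis"
      then obtain w where "w \<in> M (x u')" "w \<notin> M (x u)" by blast
      moreover have e': "(u', u) \<in> flip_arcs k x (parcs D1)" using e by (simp add: flip_arcs_converse)
      moreover have "u \<in> V" "u' \<in> V" using e' R1 by (auto simp: flip_arcs_def)
      ultimately show False
        using no3[OF F1[OF e'] F12[of u w] F21[of u' w]] by (auto simp: M_def)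
    qed
    have "acyclic (flip_arcs k x ((parcs D1)\<inverse>))" "(parcs D1)\<inverse> \<subseteq> V \<times> V"
      using acyc1 R1 by (auto simp: flip_arcs_converse acyclic_converse)
    then have "\<exists>x'. acyclic (flip_arcs (k - 1) x' ((parcs D1)\<inverse>))"
      using chain_saves_inversion[OF _ fin _ _ chain mono that(2,1), where x = y and k = k]
      by (auto simp: M_def)
    then show False using no1 by (simp add: flip_arcs_converse acyclic_converse)
  qed

  \<comment> \<open>The all-ones vector, the one annihilator that
    \<open>annihilator_saves_inversion\<close> may leave.\<close>
  define e where "e = (\<lambda>i. of_bool (i < k) :: bit)"
  have e_eq: "z = e" if "\<forall>i\<ge>k. z i = 0" "\<forall>i<k. z i = 1" for z
  proof
    show "z i = e i" for i using that by (cases "i < k") (auto simp: e_def)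
  qed
  have ann1: "z = (\<lambda>_. 0) \<or> z = e \<and> dot k z z = 1"
    if "\<forall>i\<ge>k. z i = 0" "\<forall>u\<in>V. dot k z (x u) = 0" for z
  proof (rule ccontr)
    assume neg: "\<not> ?thesis"
    have "dot k z z = 0 \<or> (\<exists>i<k. z i = 0)"
      using neg e_eq[OF that(1)] bit_not_zero_iff by metis
    then have "\<exists>r. acyclic (flip_arcs (k - 1) r (parcs D1))"
      using that neg by (intro annihilator_saves_inversion[OF R1 acyc1, of z]) auto
    then show False using no1 by blast
  qed
  have ann2: "z = (\<lambda>_. 0) \<or> z = e \<and> dot k z z = 1"
    if "\<forall>i\<ge>k. z i = 0" "\<forall>w\<in>W. dot k z (y w) = 0" for z
  proof (rule ccontr)
    assume neg: "\<not> ?thesis"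
    have "dot k z z = 0 \<or> (\<exists>i<k. z i = 0)"
      using neg e_eq[OF that(1)] bit_not_zero_iff by metis
    then have "\<exists>r. acyclic (flip_arcs (k - 1) r (parcs D2))"
      using that neg by (intro annihilator_saves_inversion[OF R2 acyc2, of z]) auto
    then show False using no2 by blast
  qed
  have sep1: False if "\<And>z. \<forall>i\<ge>k. z i = 0 \<Longrightarrow> \<forall>w\<in>W. dot k z (y w) = 0 \<Longrightarrow>
      z = (\<lambda>_. 0)"
  proof (rule det1)
    fix u assume "u \<in> V" "M (x u) = {}"
    then show "x u = (\<lambda>_. 0)" by (intro that) (auto simp: M_def x_def supp)
  next
    show "inj_on M (x ` V)"
    proof (rule inj_onI, clarify)
      fix u u' assume u: "u \<in> V" "u' \<in> V" and eq: "M (x u) = M (x u')"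
      have "dot k (x u) (y w) = dot k (x u') (y w)" if "w \<in> W" for w
        using eq that unfolding M_def set_eq_iff by (subst bit_eq_iff_eq_1) blast
      then have "(\<lambda>i. x u i + x u' i) = (\<lambda>_. 0)"
        by (intro that) (use u in \<open>auto simp: x_def supp dot_add_left\<close>)
      then show "x u = x u'" by (auto simp: fun_eq_iff bit_add_eq_0_iff)
    qed
  qed
  \<comment> \<open>Only single vectors \<open>y w\<close> and sums of two of them must be tested;
    this restriction makes the first case below work.\<close>
  have sep2: False if "\<And>z. \<forall>i\<ge>k. z i = 0 \<Longrightarrow> \<forall>u\<in>V. dot k z (x u) = 0 \<Longrightarrow>
      (\<exists>w\<in>W. \<exists>w'\<in>W. z = y w \<or> z = (\<lambda>i. y w i + y w' i)) \<Longrightarrow> z = (\<lambda>_. 0)"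
  proof (rule det2)
    fix w assume "w \<in> W" "N (y w) = {}"
    then show "y w = (\<lambda>_. 0)" by (intro that) (auto simp: N_def y_def supp)
  next
    show "inj_on N (y ` W)"
    proof (rule inj_onI, clarify)
      fix w w' assume w: "w \<in> W" "w' \<in> W" and eq: "N (y w) = N (y w')"
      have "dot k (y w) (x u) = dot k (y w') (x u)" if "u \<in> V" for u
        using eq that unfolding N_def set_eq_iff by (subst bit_eq_iff_eq_1) blast
      then have "(\<lambda>i. y w i + y w' i) = (\<lambda>_. 0)"
        by (intro that) (use w in \<open>auto simp: y_def supp dot_add_left\<close>)
      then show "y w = y w'" by (auto simp: fun_eq_iff bit_add_eq_0_iff)
    qed
  qed
  \<comment> \<open>If \<open>e\<close> is orthogonal to all \<open>y w\<close>, it is orthogonal to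
    every \<open>z\<close> tested in \<open>sep2\<close>, so \<open>z = e\<close> with square 1 is
    impossible. Otherwise \<open>e\<close> does not annihilate the \<open>y w\<close>, and
    \<open>ann2\<close> leaves only zero.\<close>
  show False
  proof (cases "\<forall>w\<in>W. dot k e (y w) = 0")
    case True
    show False
    proof (rule sep2)
      fix z assume z: "\<forall>i\<ge>k. z i = 0" "\<forall>u\<in>V. dot k z (x u) = 0"
        "\<exists>w\<in>W. \<exists>w'\<in>W. z = y w \<or> z = (\<lambda>i. y w i + y w' i)"
      have "dot k e z = 0" using z(3) True by (auto simp: dot_add_right)
      then show "z = (\<lambda>_. 0)" using ann1[OF z(1,2)] by auto
    qed
  next
    case False
    show False
    proof (rule sep1)
      fix z assume z: "\<forall>i\<ge>k. z i = 0" "\<forall>w\<in>W. dot k z (y w) = 0"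
      show "z = (\<lambda>_. 0)" using ann2[OF z] z(2) False by blast
    qed
  qed
qed

end
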